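(* Let $n\ge2$ and let $\alpha_1,\alpha_2,\alpha_3\in S_n$ satisfy $\Delta_n^+=\Phi(\alpha_1)\sqcup\Phi(\alpha_2)\sqcup\Phi(\alpha_3)$. The set $$S_{\alpha_1,\alpha_2,\alpha_3}=\{v\in\Delta_n^+\mid -\alpha_1(v)\text{ is simple or }-\alpha_2(v)\text{ is simple or }-\alpha_3(v)\text{ is simple}\}$$ is a basis of $\mathbb R^{n-1}$. Furthermore, this set can be labeled $\{v_1,v_2,\dots,v_{n-1}\}$ so that, for $i<j$, the $v_i$-pivot variable is not a $v_j$-free variable.
   Context: $\Delta_n^+=\{(i,j)\mid1\le i<j\le n\}$; for $\alpha\in S_n$, $\Phi(\alpha)=\{(i,j)\in\Delta_n^+\mid\alpha(i)>\alpha(j)\}$; $\sqcup$ is disjoint union (empty sets allowed). The element $(i,j)\in\Delta_n^+$ is identified with the vector $e_i-e_j$, where $e_1,\dots,e_n$ is the standard basis of $\mathbb R^n$, and $\mathbb R^{n-1}$ denotes the $(n-1)$-dimensional space with basis the simple roots $e_i-e_{i+1}$, $1\le i\le n-1$. $S_n$ acts by $\alpha(e_i-e_j)=e_{\alpha(i)}-e_{\alpha(j)}$. A vector is called simple if it equals $e_i-e_{i+1}$ for some $1\le i\le n-1$. Consider $3(n-1)$ variables $a_i,b_i,c_i$ ($1\le i\le n-1$), the $a_i$ being attached to $\alpha_1$, the $b_i$ to $\alpha_2$, and the $c_i$ to $\alpha_3$. Let $v\in S_{\alpha_1,\alpha_2,\alpha_3}$. By the hypothesis exactly one of $\alpha_1(v),\alpha_2(v),\alpha_3(v)$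 is a negative root (the negative of an element of $\Delta_n^+$). If it is $\alpha_1(v)$, then $\alpha_1(v)=-(e_i-e_{i+1})$, $\alpha_2(v)=e_k-e_l$ and $\alpha_3(v)=e_p-e_q$ with $k<l$, $p<q$; in this case $a_i$ is called the $v$-pivot variable and $b_k,\dots,b_{l-1},c_p,\dots,c_{q-1}$ are called the $v$-free variables. The definitions when $\alpha_2(v)$ or $\alpha_3(v)$ is the negative root are analogous (with the roles of $a,b,c$ permuted accordingly). *)

theory Defs
  imports "HOL-Analysis.Finite_Function_Topology" "HOL-Combinatorics.Permutations"
begin

text \<open>
  \<open>\<real>\<^sup>n\<close> is the subspace of the real vector space \<open>nat \<Rightarrow>\<^sub>0 real\<close> of finitely supported
  functions spanned by \<open>e 1, \<dots>, e n\<close>, so that \<open>n\<close> can be an ordinary natural number.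
  Elements of \<open>S\<^sub>n\<close> are functions \<open>\<alpha>\<close> with \<open>\<alpha> permutes {1..n}\<close>.
\<close>

type_synonym vec = "nat \<Rightarrow>\<^sub>0 real"

definition e :: "nat \<Rightarrow> vec" where
  "e i = Poly_Mapping.single i 1"

definition Delta :: "nat \<Rightarrow> (nat \<times> nat) set" where
  "Delta n = {(i, j). 1 \<le> i \<and> i < j \<and> j \<le> n}"

definition Phi :: "nat \<Rightarrow> (nat \<Rightarrow> nat) \<Rightarrow> (nat \<times> nat) set" where
  "Phi n \<alpha> = {(i, j) \<in> Delta n. \<alpha> i > \<alpha> j}"

text \<open>The vector with which a pair is identified.\<close>

definition root_vec :: "nat \<times> nat \<Rightarrow> vec" where
  "root_vec p = e (fst p) - e (snd p)"

definition negative_root :: "nat \<Rightarrow> vec \<Rightarrow> bool" where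
  "negative_root n x \<longleftrightarrow> - x \<in> root_vec ` Delta n"

definition simple_roots :: "nat \<Rightarrow> vec set" where
  "simple_roots n = {e i - e (i + 1) | i. 1 \<le> i \<and> i \<le> n - 1}"

text \<open>The space written \<open>\<real>\<^bsup>n-1\<^esup>\<close>.\<close>

definition root_space :: "nat \<Rightarrow> vec set" where
  "root_space n = span (simple_roots n)"

text \<open>The linear extension of \<open>e i \<mapsto> e (\<alpha> i)\<close>.\<close>

definition act :: "(nat \<Rightarrow> nat) \<Rightarrow> vec \<Rightarrow> vec" where
  "act \<alpha> x = (\<Sum>i\<in>Poly_Mapping.keys x. Poly_Mapping.lookup x i *\<^sub>R e (\<alpha> i))"

definition S_set :: "nat \<Rightarrow> (nat \<Rightarrow> nat) \<Rightarrow> (nat \<Rightarrow> nat) \<Rightarrow> (nat \<Rightarrow> nat) \<Rightarrow> vec set" where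
  "S_set n \<alpha>\<^sub>1 \<alpha>\<^sub>2 \<alpha>\<^sub>3 = {v \<in> root_vec ` Delta n.
     - act \<alpha>\<^sub>1 v \<in> simple_roots n \<or> - act \<alpha>\<^sub>2 v \<in> simple_roots n \<or> - act \<alpha>\<^sub>3 v \<in> simple_roots n}"

text \<open>The variables \<open>a\<^sub>i\<close>, \<open>b\<^sub>i\<close>, \<open>c\<^sub>i\<close>, attached to \<open>\<alpha>\<^sub>1\<close>, \<open>\<alpha>\<^sub>2\<close>, \<open>\<alpha>\<^sub>3\<close> respectively.\<close>

datatype var = VarA nat | VarB nat | VarC nat

text \<open>
  For a simple root \<open>e i - e (i + 1)\<close> the index is \<open>i\<close>; for \<open>e k - e l\<close> with \<open>k < l\<close> the
  segment is \<open>{k..<l}\<close>. On other vectors these values are not meaningful.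
\<close>

definition simple_index :: "nat \<Rightarrow> vec \<Rightarrow> nat" where
  "simple_index n x = (THE i. 1 \<le> i \<and> i \<le> n - 1 \<and> x = e i - e (i + 1))"

definition segment :: "nat \<Rightarrow> vec \<Rightarrow> nat set" where
  "segment n x = {m. \<exists>k l. (k, l) \<in> Delta n \<and> x = e k - e l \<and> k \<le> m \<and> m \<le> l - 1}"

text \<open>
  Both notions are meant for \<open>v \<in> S_set n \<alpha>\<^sub>1 \<alpha>\<^sub>2 \<alpha>\<^sub>3\<close> when \<open>Delta n\<close> is the disjoint union
  of the three inversion sets, so that exactly one of the three images of \<open>v\<close> is a
  negative root, namely the negative of a simple root. Then exactly one branch applies.
\<close>

definition pivot_var ::
  "nat \<Rightarrow> (nat \<Rightarrow> nat) \<Rightarrow> (nat \<Rightarrow> nat) \<Rightarrow> (nat \<Rightarrow> nat) \<Rightarrow> vec \<Rightarrow> var" where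
  "pivot_var n \<alpha>\<^sub>1 \<alpha>\<^sub>2 \<alpha>\<^sub>3 v =
     (if negative_root n (act \<alpha>\<^sub>1 v) then VarA (simple_index n (- act \<alpha>\<^sub>1 v))
      else if negative_root n (act \<alpha>\<^sub>2 v) then VarB (simple_index n (- act \<alpha>\<^sub>2 v))
      else VarC (simple_index n (- act \<alpha>\<^sub>3 v)))"

definition free_vars ::
  "nat \<Rightarrow> (nat \<Rightarrow> nat) \<Rightarrow> (nat \<Rightarrow> nat) \<Rightarrow> (nat \<Rightarrow> nat) \<Rightarrow> vec \<Rightarrow> var set" where
  "free_vars n \<alpha>\<^sub>1 \<alpha>\<^sub>2 \<alpha>\<^sub>3 v =
     (if negative_root n (act \<alpha>\<^sub>1 v)
        then VarB ` segment n (act \<alpha>\<^sub>2 v) \<union> VarC ` segment n (act \<alpha>\<^sub>3 v)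
      else if negative_root n (act \<alpha>\<^sub>2 v)
        then VarA ` segment n (act \<alpha>\<^sub>1 v) \<union> VarC ` segment n (act \<alpha>\<^sub>3 v)
      else VarA ` segment n (act \<alpha>\<^sub>1 v) \<union> VarB ` segment n (act \<alpha>\<^sub>2 v))"

lemma e_diff_eq_iff:
  assumes "i \<noteq> j"
  shows "e i - e j = e k - e l \<longleftrightarrow> i = k \<and> j = l"
proof
  assume "e i - e j = e k - e l"
  then have "Poly_Mapping.lookup (e i - e j) m = Poly_Mapping.lookup (e k - e l) m" for m
    by simp
  from this[of i] this[of j] assms show "i = k \<and> j = l"
    by (auto simp: e_def lookup_minus lookup_single when_def split: if_splits)
qed simp

lemma act_e_diff: "act \<alpha> (e i - e j) = e (\<alpha> i) - e (\<alpha> j)"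
proof (cases "i = j")
  case False
  have "Poly_Mapping.keys (e i - e j) = {i, j}"
    using False by (auto simp: e_def in_keys_iff lookup_minus lookup_single when_def split: if_splits)
  with False show ?thesis
    by (simp add: act_def e_def lookup_minus lookup_single)
qed (simp add: act_def)

lemma simple_index_eq:
  assumes "1 \<le> i" "i \<le> n - 1"
  shows "simple_index n (e i - e (i + 1)) = i"
  unfolding simple_index_def using assms by (intro the_equality) (auto simp: e_diff_eq_iff)

lemma segment_eq:
  assumes "(k, l) \<in> Delta n"
  shows "segment n (e k - e l) = {k..<l}"
proof -
  have "k \<noteq> l" "1 \<le> l" using assms by (auto simp: Delta_def)
  then show ?thesis using assms by (auto simp: segment_def e_diff_eq_iff)
qed

lemma negative_root_act_iff:
  assumes "\<alpha> permutes {1..n}" and "p \<in> Delta n"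
  shows "negative_root n (act \<alpha> (root_vec p)) \<longleftrightarrow> p \<in> Phi n \<alpha>"
proof -
  obtain i j where p: "p = (i, j)" and ij: "i \<noteq> j" "i \<in> {1..n}" "j \<in> {1..n}"
    using assms(2) by (auto simp: Delta_def)
  have "\<alpha> i \<in> {1..n}" "\<alpha> j \<in> {1..n}" "\<alpha> j \<noteq> \<alpha> i"
    using assms(1) ij by (simp_all add: permutes_in_image inj_eq[OF permutes_inj[OF assms(1)]]
        del: atLeastAtMost_iff)
  then show ?thesis
    using assms(2) by (auto simp: p negative_root_def root_vec_def act_e_diff Phi_def Delta_def image_iff
        e_diff_eq_iff)
qed

end

theory Submission
  imports Defs
begin

text \<open>
  Colour a pair \<open>i < j\<close> by the unique \<open>c\<close> for which \<open>\<alpha>\<^sub>c\<close> inverts it. The set \<open>S\<close> consists of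
  the pairs of colour \<open>c\<close> that are adjacent in the linear order given by \<open>\<alpha>\<^sub>c\<close>.
  If the pivot variable of \<open>v\<close> is a free variable of \<open>v' = (i, j)\<close>, then the interval of \<open>v\<close> is
  properly contained in that of \<open>v'\<close>: a point of \<open>v\<close> outside \<open>[i, j]\<close> would separate \<open>i\<close> from \<open>j\<close>
  in the order of the colour of \<open>v'\<close>. So ordering \<open>S\<close> by decreasing length gives the labelling, and
  this triangular shape makes \<open>S\<close> independent. For the size of \<open>S\<close>, restrict the orders to
  \<open>{1..m}\<close> and let \<open>m\<close> grow: inserting \<open>m + 1\<close> into the order of colour \<open>c\<close> destroys at most one
  adjacent descent and then creates another one; for the colour whose new descent
  \<open>(y, m + 1)\<close> has the largest \<open>y\<close>, nothing is destroyed. Hence \<open>S\<close> has at least \<open>n - 1\<close> elements.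
\<close>

lemma lookup_scaleR:
  "Poly_Mapping.lookup (r *\<^sub>R x) k = r *\<^sub>R Poly_Mapping.lookup x k"
proof -
  have "finite {k. r *\<^sub>R Poly_Mapping.lookup x k \<noteq> 0}"
    by (rule finite_subset[OF _ finite_lookup[of x]]) auto
  then show ?thesis by (simp add: scaleR_poly_mapping_def Abs_poly_mapping_inverse)
qed

section \<open>Colourings of pairs by inversions, and adjacent descents\<close>

text \<open>An abstract type of colours keeps the arguments symmetric in the permutations. The last
  two assumptions express that the inversion sets cover \<open>Delta n\<close> and are pairwise
  disjoint.\<close>

locale inversion_partition =
  fixes n :: nat and \<alpha> :: "'c \<Rightarrow> nat \<Rightarrow> nat"
  assumes permutes: "\<alpha> c permutes {1..n}"
    and ex_colour: "(i, j) \<in> Delta n \<Longrightarrow> \<exists>c. \<alpha> c j < \<alpha> c i"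
    and colour_unique: "(i, j) \<in> Delta n \<Longrightarrow> \<alpha> c j < \<alpha> c i \<Longrightarrow> \<alpha> d j < \<alpha> d i \<Longrightarrow> c = d"
begin

lemma alpha_eq_iff [simp]: "\<alpha> c i = \<alpha> c j \<longleftrightarrow> i = j"
  using inj_eq[OF permutes_inj[OF permutes]] .

lemma alpha_in_range:
  assumes "(i, j) \<in> Delta n"
  shows "\<alpha> c i \<in> {1..n}" "\<alpha> c j \<in> {1..n}" "\<alpha> c i \<noteq> \<alpha> c j"
proof -
  have "i \<in> {1..n}" "j \<in> {1..n}" "i \<noteq> j" using assms by (auto simp: Delta_def)
  then show "\<alpha> c i \<in> {1..n}" "\<alpha> c j \<in> {1..n}" "\<alpha> c i \<noteq> \<alpha> c j"
    by (simp_all only: permutes_in_image[OF permutes] alpha_eq_iff not_False_eq_True)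
qed

lemma not_inverted:
  assumes "(i, j) \<in> Delta n" "\<alpha> c j < \<alpha> c i" "d \<noteq> c"
  shows "\<alpha> d i < \<alpha> d j"
proof -
  have "\<not> \<alpha> d j < \<alpha> d i" "i \<noteq> j"
    using assms colour_unique[OF assms(1,2), of d] by (auto simp: Delta_def)
  then show ?thesis by (metis alpha_eq_iff linorder_neqE_nat)
qed

text \<open>Betweenness is tested only against points of \<open>{1..m}\<close>, so the order
  restricted to an initial segment keeps the original values of \<open>\<alpha> c\<close> and no
  renumbering occurs. This makes an induction on \<open>m\<close> possible.\<close>

definition edge :: "nat \<Rightarrow> 'c \<Rightarrow> nat \<Rightarrow> nat \<Rightarrow> bool" where
  "edge m c i j \<longleftrightarrow> (i, j) \<in> Delta m \<and> \<alpha> c j < \<alpha> c i \<and>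
     (\<forall>k\<in>{1..m}. \<not> (\<alpha> c j < \<alpha> c k \<and> \<alpha> c k < \<alpha> c i))"

definition edges :: "nat \<Rightarrow> (nat \<times> nat) set" where
  "edges m = {(i, j). \<exists>c. edge m c i j}"

lemma finite_edges: "finite (edges m)"
  by (rule finite_subset[of _ "{1..m} \<times> {1..m}"]) (auto simp: edges_def edge_def Delta_def)

text \<open>The values of \<open>\<alpha> c\<close> on \<open>{1..n}\<close> are all of
  \<open>{1..n}\<close>, so a gap between the two values of a descent would be filled by some
  point.\<close>

lemma edge_iff: "edge n c i j \<longleftrightarrow> (i, j) \<in> Delta n \<and> \<alpha> c i = Suc (\<alpha> c j)"
proof
  assume e: "edge n c i j"
  have "\<alpha> c i \<in> {1..n}" "\<alpha> c j \<in> {1..n}"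
    using e alpha_in_range unfolding edge_def by blast+
  moreover have lt: "\<alpha> c j < \<alpha> c i" using e by (simp add: edge_def)
  ultimately have "Suc (\<alpha> c j) \<in> {1..n}" by auto
  then have "Suc (\<alpha> c j) \<in> \<alpha> c ` {1..n}" by (simp only: permutes_image[OF permutes])
  then obtain k where "k \<in> {1..n}" "\<alpha> c k = Suc (\<alpha> c j)" by (metis imageE)
  then have "\<not> \<alpha> c k < \<alpha> c i" using e unfolding edge_def by (metis lessI)
  then show "(i, j) \<in> Delta n \<and> \<alpha> c i = Suc (\<alpha> c j)"
    using e lt \<open>\<alpha> c k = _\<close> by (simp add: edge_def)
qed (auto simp: edge_def)

text \<open>Suppose \<open>p < i\<close>. Then \<open>d\<close> inverts \<open>(p, i)\<close>, so no
  other colour does. The colour \<open>f\<close> of \<open>(p, j)\<close> is not \<open>d\<close> by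
  \<open>str\<close>, hence \<open>\<alpha> f j < \<alpha> f p < \<alpha> f i\<close>, which forces
  \<open>f = c\<close> and puts \<open>p\<close> strictly between the adjacent points
  \<open>j\<close> and \<open>i\<close>. The case \<open>j < q\<close> is the mirror image. Equality
  of the two pairs is excluded because their colours differ.\<close>

lemma straddled_nested:
  assumes e: "edge n c i j" and pq: "(p, q) \<in> Delta n" "\<alpha> d q < \<alpha> d p" and "d \<noteq> c"
    and str: "\<alpha> d i \<le> \<alpha> d q" "\<alpha> d p \<le> \<alpha> d j"
  shows "q - p < j - i"
proof -
  have ij: "(i, j) \<in> Delta n" "\<alpha> c j < \<alpha> c i"
    and adj: "\<And>k. k \<in> {1..n} \<Longrightarrow> \<alpha> c j < \<alpha> c k \<Longrightarrow> \<alpha> c k < \<alpha> c i \<Longrightarrow> False"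
    using e by (auto simp: edge_def)
  have "i \<le> p"
  proof (rule ccontr)
    assume "\<not> i \<le> p"
    then have D: "(p, i) \<in> Delta n" "(p, j) \<in> Delta n" using ij pq by (auto simp: Delta_def)
    have "\<alpha> d i < \<alpha> d p" using pq str by simp
    then have c: "\<alpha> c p < \<alpha> c i" using not_inverted D(1) \<open>d \<noteq> c\<close> by metis
    obtain f where f: "\<alpha> f j < \<alpha> f p" using ex_colour D(2) by blast
    have "f \<noteq> d" using f str by auto
    then have "\<alpha> f p < \<alpha> f i" using not_inverted D(1) \<open>\<alpha> d i < \<alpha> d p\<close> by metis
    then have "\<alpha> f j < \<alpha> f i" using f by simp
    then have "f = c" using colour_unique ij by blast
    then show False using adj[of p] c f D by (auto simp: Delta_def)
  qed
  moreover have "q \<le> j"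
  proof (rule ccontr)
    assume "\<not> q \<le> j"
    then have D: "(j, q) \<in> Delta n" "(i, q) \<in> Delta n" using ij pq by (auto simp: Delta_def)
    have "\<alpha> d q < \<alpha> d j" using pq str by simp
    then have c: "\<alpha> c j < \<alpha> c q" using not_inverted D(1) \<open>d \<noteq> c\<close> by metis
    obtain f where f: "\<alpha> f q < \<alpha> f i" using ex_colour D(2) by blast
    have "f \<noteq> d" using f str by auto
    then have "\<alpha> f j < \<alpha> f q" using not_inverted D(1) \<open>\<alpha> d q < \<alpha> d j\<close> by metis
    then have "\<alpha> f j < \<alpha> f i" using f by simp
    then have "f = c" using colour_unique ij by blast
    then show False using adj[of q] c f D by (auto simp: Delta_def)
  qed
  moreover have "\<not> (p = i \<and> q = j)"
    using ij pq \<open>d \<noteq> c\<close> colour_unique by blast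
  ultimately show ?thesis using pq ij by (auto simp: Delta_def)
qed

section \<open>Counting adjacent descents\<close>

lemma ex_new_edge:
  assumes "x \<in> {1..m}" "\<alpha> c (Suc m) < \<alpha> c x"
  shows "\<exists>y. edge (Suc m) c y (Suc m) \<and> \<alpha> c y \<le> \<alpha> c x"
proof -
  define C where "C = {k \<in> {1..m}. \<alpha> c (Suc m) < \<alpha> c k}"
  have "x \<in> C" "finite C" using assms by (auto simp: C_def)
  then have "C \<noteq> {}" by auto
  \<comment> \<open>The point of \<open>{1..m}\<close> lying directly above \<open>Suc m\<close> in
    the order of colour \<open>c\<close>.\<close>
  define y where "y = arg_min_on (\<alpha> c) C"
  have y: "y \<in> C" "\<And>k. k \<in> C \<Longrightarrow> \<alpha> c y \<le> \<alpha> c k"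
    unfolding y_def using arg_min_if_finite(1)[OF \<open>finite C\<close> \<open>C \<noteq> {}\<close>]
      arg_min_least[OF \<open>finite C\<close> \<open>C \<noteq> {}\<close>] by auto
  have no_between: False if "k \<in> {1..Suc m}" "\<alpha> c (Suc m) < \<alpha> c k" "\<alpha> c k < \<alpha> c y" for k
  proof -
    have "k \<noteq> Suc m" using that by auto
    then have "k \<in> C" using that by (auto simp: C_def)
    then show False using y(2) that by fastforce
  qed
  have "(y, Suc m) \<in> Delta (Suc m)" "\<alpha> c (Suc m) < \<alpha> c y"
    using y(1) by (auto simp: C_def Delta_def)
  then have "edge (Suc m) c y (Suc m)" using no_between unfolding edge_def by blast
  then show ?thesis using y(2) \<open>x \<in> C\<close> by blast
qed

text \<open>Among the new edges \<open>(y, Suc m)\<close> of all colours, take one with the largest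
  \<open>y\<close>. If it destroyed an old edge \<open>(y, x)\<close>, the pair
  \<open>(x, Suc m)\<close> would have another colour \<open>d\<close>, whose new edge starts at
  some \<open>z < y\<close>. The colour of \<open>(z, x)\<close> then turns out to be
  \<open>c\<close>, so that \<open>z\<close> already separated \<open>x\<close> from
  \<open>y\<close>.\<close>

lemma surplus_new_edge:
  assumes m: "1 \<le> m" "Suc m \<le> n"
  shows "\<exists>c y. edge (Suc m) c y (Suc m) \<and>
    (\<forall>x. edge m c y x \<longrightarrow> \<alpha> c (Suc m) < \<alpha> c x)"
proof -
  define Y where "Y = {y. \<exists>c. edge (Suc m) c y (Suc m)}"
  have "finite Y"
    by (rule finite_subset[of _ "{1..m}"]) (auto simp: Y_def edge_def Delta_def)
  have D: "(k, Suc m) \<in> Delta n" if "k \<in> {1..m}" for k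
    using m that by (auto simp: Delta_def)
  \<comment> \<open>The pair \<open>(m, Suc m)\<close> has some colour, and in that colour a new
    edge arises.\<close>
  have "Y \<noteq> {}"
    using ex_colour[OF D[of m]] ex_new_edge[of m m] m unfolding Y_def by fastforce
  define y where "y = Max Y"
  have "y \<in> Y" and y_max: "\<And>z. z \<in> Y \<Longrightarrow> z \<le> y"
    using \<open>finite Y\<close> \<open>Y \<noteq> {}\<close> by (auto simp: y_def)
  then obtain c where y: "edge (Suc m) c y (Suc m)" by (auto simp: Y_def)
  have "\<alpha> c (Suc m) < \<alpha> c x" if x: "edge m c y x" for x
  proof (rule ccontr)
    assume not_less: "\<not> \<alpha> c (Suc m) < \<alpha> c x"
    have x_in: "x \<in> {1..m}" "y \<in> {1..m}" and yx: "(y, x) \<in> Delta n" "\<alpha> c x < \<alpha> c y"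
      using x m by (auto simp: edge_def Delta_def)
    have yN: "\<alpha> c (Suc m) < \<alpha> c y" using y by (simp add: edge_def)
    obtain d where d: "\<alpha> d (Suc m) < \<alpha> d x" using ex_colour D x_in by blast
    then have "d \<noteq> c" using not_less by auto
    obtain z where z: "edge (Suc m) d z (Suc m)" "\<alpha> d z \<le> \<alpha> d x"
      using ex_new_edge[OF x_in(1) d] by blast
    have z_in: "z \<in> {1..m}" and zN: "\<alpha> d (Suc m) < \<alpha> d z"
      using z(1) by (auto simp: edge_def Delta_def)
    have "\<alpha> d y < \<alpha> d (Suc m)" using not_inverted[OF D[OF x_in(2)] yN \<open>d \<noteq> c\<close>] .
    with zN have zy: "\<alpha> d y < \<alpha> d z" by simp
    \<comment> \<open>Maximality gives \<open>z \<le> y\<close>; equality is impossible since the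
      \<open>d\<close>-values of \<open>y\<close> and \<open>z\<close> lie on opposite sides of that
      of \<open>Suc m\<close>.\<close>
    have "z < y" using y_max[of z] z(1) zy by (auto simp: Y_def order_le_less)
    then have Dz: "(z, y) \<in> Delta n" "(z, x) \<in> Delta n"
      using yx z_in by (auto simp: Delta_def)
    obtain f where f: "\<alpha> f x < \<alpha> f z" using ex_colour Dz(2) by blast
    have "f \<noteq> d" using f z(2) by auto
    then have "\<alpha> f z < \<alpha> f y" using not_inverted[OF Dz(1) zy] by blast
    then have "f = c" using colour_unique[OF yx(1), of f c] yx f by simp
    have "\<alpha> c z < \<alpha> c (Suc m)" using not_inverted[OF D[OF z_in] zN, of c] \<open>d \<noteq> c\<close> by simp
    \<comment> \<open>Now \<open>\<alpha> c x < \<alpha> c z < \<alpha> c (Suc m) < \<alpha> c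
      y\<close>, against the adjacency of \<open>y\<close> and \<open>x\<close>.\<close>
    then show False using x z_in f yN unfolding \<open>f = c\<close> edge_def by fastforce
  qed
  then show ?thesis using y by blast
qed

text \<open>The map \<open>g\<close> injects the old edges into the new ones: a surviving edge is
  kept, and an edge destroyed by \<open>Suc m\<close> is replaced by its upper half in the order,
  which still starts at the same point. The surplus edge is missed by \<open>g\<close>, which gives
  the extra element.\<close>

lemma card_edges_Suc:
  assumes m: "1 \<le> m" "Suc m \<le> n"
  shows "Suc (card (edges m)) \<le> card (edges (Suc m))"
proof -
  define g where
    "g p = (if p \<in> edges (Suc m) then p else (fst p, Suc m))" for p :: "nat \<times> nat"
  have D: "(k, Suc m) \<in> Delta n" if "k \<in> {1..m}" for k
    using m that by (auto simp: Delta_def)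
  have lost: "\<alpha> c j < \<alpha> c (Suc m) \<and> \<alpha> c (Suc m) < \<alpha> c i"
    if "edge m c i j" "(i, j) \<notin> edges (Suc m)" for c i j
  proof -
    have "\<not> edge (Suc m) c i j" using that(2) by (auto simp: edges_def)
    then show ?thesis using that(1) by (auto simp: edge_def Delta_def le_Suc_eq)
  qed
  have new: "edge (Suc m) c i (Suc m)"
    if "edge m c i j" "\<alpha> c j < \<alpha> c (Suc m)" "\<alpha> c (Suc m) < \<alpha> c i" for c i j
    using that by (auto simp: edge_def Delta_def le_Suc_eq)
  have range: "g p \<in> edges (Suc m)" if p: "p \<in> edges m" for p
  proof -
    obtain i j c where "p = (i, j)" "edge m c i j" using p by (auto simp: edges_def)
    then show ?thesis using lost[of c i j] new[of c i j] by (auto simp: g_def edges_def)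
  qed
  have small: "fst p \<in> {1..m} \<and> snd p \<in> {1..m}" if "p \<in> edges m" for p
    using that by (auto simp: edges_def edge_def Delta_def)
  have inj: "inj_on g (edges m)"
  proof (rule inj_onI)
    fix p q assume pq: "p \<in> edges m" "q \<in> edges m" "g p = g q"
    obtain i j c where p: "p = (i, j)" "edge m c i j" using pq by (auto simp: edges_def)
    obtain i' j' d where q: "q = (i', j')" "edge m d i' j'" using pq by (auto simp: edges_def)
    show "p = q"
    proof (cases "p \<in> edges (Suc m) \<or> q \<in> edges (Suc m)")
      case True
      then show ?thesis using pq(3) small[OF pq(1)] small[OF pq(2)]
        by (auto simp: g_def split: if_splits)
    next
      case False
      then have "i = i'" using pq(3) p q by (simp add: g_def)
      have i: "i \<in> {1..m}" using small[OF pq(1)] p by simp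
      have l: "\<alpha> c j < \<alpha> c (Suc m) \<and> \<alpha> c (Suc m) < \<alpha> c i"
        "\<alpha> d j' < \<alpha> d (Suc m) \<and> \<alpha> d (Suc m) < \<alpha> d i"
        using lost False p q \<open>i = i'\<close> by blast+
      \<comment> \<open>Both colours invert \<open>(i, Suc m)\<close>. After that, \<open>j\<close>
        and \<open>j'\<close> are both the point directly below \<open>i\<close> in one order on
        \<open>{1..m}\<close>, hence equal.\<close>
      then have "c = d" using colour_unique[OF D[OF i], of c d] by blast
      have "\<not> \<alpha> c j < \<alpha> c j'" "\<not> \<alpha> c j' < \<alpha> c j"
        using p q small[OF pq(1)] small[OF pq(2)] l unfolding \<open>c = d\<close> \<open>i = i'\<close> edge_def
        by auto
      then have "j = j'" by (metis alpha_eq_iff linorder_neqE_nat)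
      then show ?thesis using p q \<open>i = i'\<close> by simp
    qed
  qed
  obtain c y where y: "edge (Suc m) c y (Suc m)"
    "\<And>x. edge m c y x \<Longrightarrow> \<alpha> c (Suc m) < \<alpha> c x"
    using surplus_new_edge[OF m] by blast
  have y_in: "y \<in> {1..m}" "\<alpha> c (Suc m) < \<alpha> c y" using y(1) by (auto simp: edge_def Delta_def)
  \<comment> \<open>A preimage would be a destroyed edge starting at \<open>y\<close>; its colour
    inverts \<open>(y, Suc m)\<close>, so it is \<open>c\<close>, contrary to the choice of the
    surplus edge.\<close>
  have "(y, Suc m) \<notin> g ` edges m"
  proof
    assume "(y, Suc m) \<in> g ` edges m"
    then obtain x where x: "x \<in> edges m" "g x = (y, Suc m)" by (metis imageE)
    then obtain i j d where p: "(i, j) \<in> edges m" "g (i, j) = (y, Suc m)" "edge m d i j"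
      unfolding edges_def by blast
    then have "(i, j) \<notin> edges (Suc m)" "i = y"
      using small[OF p(1)] by (auto simp: g_def split: if_splits)
    moreover from this have l: "\<alpha> d j < \<alpha> d (Suc m)" "\<alpha> d (Suc m) < \<alpha> d y"
      using lost[OF p(3)] by auto
    moreover from l have "d = c" using colour_unique[OF D[OF y_in(1)]] y_in(2) by blast
    ultimately show False using y(2)[of j] p(3) by auto
  qed
  moreover have "(y, Suc m) \<in> edges (Suc m)" using y(1) by (auto simp: edges_def)
  ultimately have "insert (y, Suc m) (g ` edges m) \<subseteq> edges (Suc m)" using range by blast
  then have "card (insert (y, Suc m) (g ` edges m)) \<le> card (edges (Suc m))"
    by (rule card_mono[OF finite_edges])
  then show ?thesis
    using \<open>(y, Suc m) \<notin> _\<close> finite_edges[of m] by (simp add: card_image[OF inj])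
qed

lemma card_edges_ge:
  assumes "1 \<le> m" "m \<le> n"
  shows "m - 1 \<le> card (edges m)"
  using assms
proof (induction m rule: dec_induct)
  case (step m)
  then show ?case using card_edges_Suc[of m] by simp
qed simp

section \<open>Independence and span of the edge vectors\<close>

lemma inj_on_root_vec: "inj_on root_vec (Delta n)"
  by (auto simp: inj_on_def Delta_def root_vec_def e_diff_eq_iff)

lemma edges_subset: "edges n \<subseteq> Delta n"
  by (auto simp: edges_def edge_def)

text \<open>In a nontrivial relation, take a longest edge \<open>x\<close> with nonzero coefficient.
  A linear functional that is \<open>-1\<close> on \<open>x\<close> and vanishes on all other edges
  of the relation gives a contradiction.\<close>

lemma independent_edges: "independent (root_vec ` edges n)"
proof
  assume "dependent (root_vec ` edges n)"
  then obtain u where u: "\<exists>v\<in>root_vec ` edges n. u v \<noteq> 0"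
    "(\<Sum>v\<in>root_vec ` edges n. u v *\<^sub>R v) = 0"
    using finite_edges by (auto simp: dependent_finite)
  define w where "w x = u (root_vec x)" for x
  have sum0: "(\<Sum>x\<in>edges n. w x *\<^sub>R root_vec x) = 0"
    using u(2) inj_on_subset[OF inj_on_root_vec edges_subset] by (simp add: sum.reindex w_def)
  define W where "W = {x \<in> edges n. w x \<noteq> 0}"
  have "finite W" "W \<noteq> {}" using finite_edges u(1) by (auto simp: W_def w_def)
  define len :: "nat \<times> nat \<Rightarrow> nat" where "len x = snd x - fst x" for x
  have "Max (len ` W) \<in> len ` W" using \<open>finite W\<close> \<open>W \<noteq> {}\<close> by simp
  then obtain x where x: "x \<in> W" "len x = Max (len ` W)" by (metis imageE)
  have x_max: "len y \<le> len x" if "y \<in> W" for y using \<open>finite W\<close> that x(2) by simp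
  obtain p q c where pq: "x = (p, q)" "edge n c p q" using x(1) by (auto simp: W_def edges_def)
  \<comment> \<open>\<open>K\<close> is the lower part of the order of colour \<open>c\<close>, cut
    just between \<open>q\<close> and \<open>p\<close>. On the root space, \<open>L v\<close> is the
    coefficient of the simple root of index \<open>\<alpha> c q\<close> in
    \<open>act (\<alpha> c) v\<close>; on a root vector it is nonzero only if the pair crosses the
    cut.\<close>
  define K where "K = {k \<in> {1..n}. \<alpha> c k \<le> \<alpha> c q}"
  define L where "L v = (\<Sum>k\<in>K. Poly_Mapping.lookup v k)" for v :: vec
  have L_e: "L (e k) = (if k \<in> K then 1 else 0)" for k
  proof -
    have "finite K" by (simp add: K_def)
    then show ?thesis by (simp add: L_def e_def lookup_single when_def)
  qed
  have L_root: "L (root_vec (i, j)) = (if i \<in> K then 1 else 0) - (if j \<in> K then 1 else 0)" for i j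
    using L_e[of i] L_e[of j] by (simp add: L_def root_vec_def lookup_minus sum_subtractf)
  have pq': "(p, q) \<in> Delta n" "\<alpha> c p = Suc (\<alpha> c q)" using pq by (auto simp: edge_iff)
  have L_x: "L (root_vec x) = -1"
    using pq' by (auto simp: pq L_root K_def Delta_def)
  have L_other: "w y * L (root_vec y) = 0" if y: "y \<in> edges n" "y \<noteq> x" for y
  proof (cases "y \<in> W")
    case True
    obtain i j d where ij: "y = (i, j)" "edge n d i j" using y by (auto simp: edges_def)
    then have ij': "(i, j) \<in> Delta n" "\<alpha> d i = Suc (\<alpha> d j)" by (auto simp: edge_iff)
    then have r: "i \<in> {1..n}" "j \<in> {1..n}" by (auto simp: Delta_def)
    have "i \<in> K \<longleftrightarrow> j \<in> K"
    proof (cases "d = c")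
      \<comment> \<open>Within one order, the only consecutive pair crossing the cut is
        \<open>(p, q)\<close> itself.\<close>
      case d: True
      have neq: "\<alpha> c j \<noteq> \<alpha> c q"
      proof
        assume j: "\<alpha> c j = \<alpha> c q"
        then have "\<alpha> c i = \<alpha> c p" using pq'(2) ij'(2) d by simp
        then show False using j y ij pq by simp
      qed
      have "\<alpha> c i = Suc (\<alpha> c j)" using ij'(2) d by simp
      then have "\<alpha> c i \<le> \<alpha> c q \<longleftrightarrow> \<alpha> c j \<le> \<alpha> c q" using neq by linarith
      then show ?thesis using r by (simp add: K_def)
    next
      \<comment> \<open>A crossing pair of another colour straddles \<open>(p, q)\<close>, so it
        would be strictly longer than \<open>x\<close>.\<close>
      case d: False
      have lt: "\<alpha> c i < \<alpha> c j" using not_inverted[OF ij'(1), of d c] ij'(2) d by simp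
      have "\<not> (\<alpha> c i \<le> \<alpha> c q \<and> \<alpha> c p \<le> \<alpha> c j)"
        using straddled_nested[OF ij(2) pq'(1), of c] pq'(2) d x_max[OF True] ij pq
        by (auto simp: len_def)
      then show ?thesis using lt r pq'(2) by (auto simp: K_def)
    qed
    then show ?thesis by (simp add: ij L_root)
  qed (use y in \<open>simp add: W_def\<close>)
  have "0 = L (\<Sum>y\<in>edges n. w y *\<^sub>R root_vec y)" by (simp add: sum0 L_def)
  also have "\<dots> = (\<Sum>y\<in>edges n. w y * L (root_vec y))"
    by (simp add: L_def lookup_sum lookup_scaleR sum_distrib_left sum.swap[of _ "edges n"])
  also have "\<dots> = w x * L (root_vec x) + (\<Sum>y\<in>edges n - {x}. w y * L (root_vec y))"
    using x(1) by (intro sum.remove[OF finite_edges]) (simp add: W_def)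
  also have "(\<Sum>y\<in>edges n - {x}. w y * L (root_vec y)) = 0"
    by (intro sum.neutral ballI L_other) auto
  finally show False using L_x x(1) by (simp add: W_def)
qed

lemma root_vec_in_root_space:
  assumes "(i, j) \<in> Delta n"
  shows "root_vec (i, j) \<in> root_space n"
proof -
  have "i \<le> k \<Longrightarrow> 1 \<le> i \<Longrightarrow> k \<le> n \<Longrightarrow> e i - e k \<in> span (simple_roots n)" for k
  proof (induction k rule: dec_induct)
    case base
    then show ?case by (simp add: span_zero)
  next
    case (step k)
    then have "e k - e (k + 1) \<in> span (simple_roots n)"
      by (intro span_base) (auto simp: simple_roots_def)
    then have "(e i - e k) + (e k - e (k + 1)) \<in> span (simple_roots n)"
      using step by (intro span_add) auto
    then show ?case by simp
  qed
  then show ?thesis using assms by (auto simp: root_space_def root_vec_def Delta_def)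
qed

lemma simple_roots_eq: "simple_roots n = (\<lambda>i. e i - e (i + 1)) ` {1..n - 1}"
  by (auto simp: simple_roots_def)

text \<open>Independence bounds the number of edges above by the number of simple roots, at most
  \<open>n - 1\<close>, and the count of adjacent descents bounds it below.\<close>

lemma edges_basis:
  assumes "n \<ge> 2"
  shows "span (root_vec ` edges n) = root_space n" and "card (edges n) = n - 1"
proof -
  have fin: "finite (simple_roots n)" and card_simple: "card (simple_roots n) \<le> n - 1"
    using card_image_le[of "{1..n - 1}" "\<lambda>i. e i - e (i + 1)"] by (auto simp: simple_roots_eq)
  have sub: "root_vec ` edges n \<subseteq> root_space n"
    using root_vec_in_root_space edges_subset by auto
  have card_eq: "card (root_vec ` edges n) = card (edges n)"
    by (rule card_image[OF inj_on_subset[OF inj_on_root_vec edges_subset]])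
  have ge: "n - 1 \<le> card (edges n)" using card_edges_ge[of n] assms by simp
  moreover have "card (root_vec ` edges n) \<le> card (simple_roots n)"
    using independent_span_bound[OF fin independent_edges] sub by (simp add: root_space_def)
  ultimately show "card (edges n) = n - 1" using card_simple card_eq by simp
  \<comment> \<open>A vector outside the span would extend the edge vectors to at least
    \<open>n\<close> independent vectors in a space spanned by at most \<open>n - 1\<close>.\<close>
  have "x \<in> span (root_vec ` edges n)" if "x \<in> root_space n" for x
  proof (rule ccontr)
    assume x: "x \<notin> span (root_vec ` edges n)"
    then have "independent (insert x (root_vec ` edges n))" and "x \<notin> root_vec ` edges n"
      using independent_edges by (auto simp: independent_insert span_base)
    then have "card (insert x (root_vec ` edges n)) \<le> card (simple_roots n)"
      using independent_span_bound[OF fin] sub that by (simp add: root_space_def)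
    then show False
      using \<open>x \<notin> root_vec ` edges n\<close> finite_edges ge card_simple card_eq assms by simp
  qed
  moreover have "span (root_vec ` edges n) \<subseteq> root_space n"
    using sub unfolding root_space_def by (simp add: span_minimal)
  ultimately show "span (root_vec ` edges n) = root_space n" by blast
qed

section \<open>Pivot and segment data of an edge\<close>

lemma uminus_act_simple_iff:
  assumes "(i, j) \<in> Delta n"
  shows "- act (\<alpha> c) (root_vec (i, j)) \<in> simple_roots n \<longleftrightarrow> edge n c i j"
proof -
  have "i \<noteq> j" using assms by (simp add: Delta_def)
  then show ?thesis
    using assms alpha_in_range[OF assms, of c] by (auto simp: edge_iff root_vec_def act_e_diff simple_roots_def e_diff_eq_iff)
qed

text \<open>The sign reverses the image to \<open>e (\<alpha> c j) - e (\<alpha> c i)\<close>, so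
  the smaller value, attained at \<open>j\<close>, is the index.\<close>

lemma simple_index_edge:
  assumes "edge n c i j"
  shows "simple_index n (- act (\<alpha> c) (root_vec (i, j))) = \<alpha> c j"
proof -
  have D: "(i, j) \<in> Delta n" and s: "\<alpha> c i = \<alpha> c j + 1" using assms by (auto simp: edge_iff)
  from alpha_in_range(1,2)[OF D, of c] show ?thesis using simple_index_eq[of "\<alpha> c j" n] s by (simp add: root_vec_def act_e_diff)
qed

lemma segment_not_inverted:
  assumes "(i, j) \<in> Delta n" "\<not> \<alpha> c j < \<alpha> c i"
  shows "segment n (act (\<alpha> c) (root_vec (i, j))) = {\<alpha> c i..<\<alpha> c j}"
proof -
  have "\<alpha> c i < \<alpha> c j" using alpha_in_range(3)[OF assms(1), of c] assms(2) by linarith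
  then have "(\<alpha> c i, \<alpha> c j) \<in> Delta n"
    using alpha_in_range(1,2)[OF assms(1), of c] by (simp add: Delta_def)
  then show ?thesis by (simp add: root_vec_def act_e_diff segment_eq)
qed

lemma negative_root_iff:
  assumes "(i, j) \<in> Delta n"
  shows "negative_root n (act (\<alpha> c) (root_vec (i, j))) \<longleftrightarrow> \<alpha> c j < \<alpha> c i"
  using negative_root_act_iff[OF permutes assms] assms by (auto simp: Phi_def)

end

section \<open>Specialisation to three permutations, and the labelling\<close>

datatype colour = A | B | C

fun variable :: "colour \<Rightarrow> nat \<Rightarrow> var" where
  "variable A = VarA"
| "variable B = VarB"
| "variable C = VarC"

lemma variable_eq_iff: "variable c k = variable d l \<longleftrightarrow> c = d \<and> k = l"
  by (cases c; cases d) auto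

lemma ex_bij_betw_antimono:
  fixes f :: "'a \<Rightarrow> nat"
  assumes "finite E"
  shows "\<exists>g. bij_betw g {1..card E} E \<and>
    (\<forall>i\<in>{1..card E}. \<forall>j\<in>{1..card E}. i < j \<longrightarrow> f (g j) \<le> f (g i))"
proof -
  obtain xs where xs: "set xs = E" "distinct xs" using finite_distinct_list[OF assms] by blast
  define ys where "ys = rev (sort_key f xs)"
  have ys: "set ys = E" "distinct ys" "length ys = card E"
    using xs by (auto simp: ys_def distinct_card[symmetric])
  have anti: "f (ys ! b) \<le> f (ys ! a)" if "a < b" "b < card E" for a b
  proof -
    have "sorted (rev (map f ys))" by (simp add: ys_def rev_map)
    then show ?thesis using sorted_rev_nth_mono[of "map f ys" a b] that ys(3) by simp
  qed
  \<comment> \<open>Labels start at 1, list positions at 0.\<close>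
  have "bij_betw (\<lambda>k. k - 1) {1..card E} {..<card E}"
    by (rule bij_betwI[where g = Suc]) auto
  moreover have "bij_betw ((!) ys) {..<card E} E"
    using bij_betw_nth[OF ys(2)] ys by metis
  ultimately have "bij_betw ((!) ys \<circ> (\<lambda>k. k - 1)) {1..card E} E"
    by (rule bij_betw_trans)
  moreover have "f (((!) ys \<circ> (\<lambda>k. k - 1)) j) \<le> f (((!) ys \<circ> (\<lambda>k. k - 1)) i)"
    if "i \<in> {1..card E}" "j \<in> {1..card E}" "i < j" for i j
    using anti[of "i - 1" "j - 1"] that by simp
  ultimately show ?thesis by blast
qed

theorem proposition8p1:
  fixes n :: nat and \<alpha>\<^sub>1 \<alpha>\<^sub>2 \<alpha>\<^sub>3 :: "nat \<Rightarrow> nat"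
  assumes "n \<ge> 2"
    and "\<alpha>\<^sub>1 permutes {1..n}" and "\<alpha>\<^sub>2 permutes {1..n}" and "\<alpha>\<^sub>3 permutes {1..n}"
    and "Delta n = Phi n \<alpha>\<^sub>1 \<union> Phi n \<alpha>\<^sub>2 \<union> Phi n \<alpha>\<^sub>3"
    and "Phi n \<alpha>\<^sub>1 \<inter> Phi n \<alpha>\<^sub>2 = {}"
    and "Phi n \<alpha>\<^sub>1 \<inter> Phi n \<alpha>\<^sub>3 = {}"
    and "Phi n \<alpha>\<^sub>2 \<inter> Phi n \<alpha>\<^sub>3 = {}"
  shows "independent (S_set n \<alpha>\<^sub>1 \<alpha>\<^sub>2 \<alpha>\<^sub>3) \<and> span (S_set n \<alpha>\<^sub>1 \<alpha>\<^sub>2 \<alpha>\<^sub>3) = root_space n \<and>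
    (\<exists>v :: nat \<Rightarrow> vec. bij_betw v {1..n - 1} (S_set n \<alpha>\<^sub>1 \<alpha>\<^sub>2 \<alpha>\<^sub>3) \<and>
      (\<forall>i\<in>{1..n - 1}. \<forall>j\<in>{1..n - 1}. i < j \<longrightarrow>
         pivot_var n \<alpha>\<^sub>1 \<alpha>\<^sub>2 \<alpha>\<^sub>3 (v i) \<notin> free_vars n \<alpha>\<^sub>1 \<alpha>\<^sub>2 \<alpha>\<^sub>3 (v j)))"
proof -
  define \<alpha> where "\<alpha> c = (case c of A \<Rightarrow> \<alpha>\<^sub>1 | B \<Rightarrow> \<alpha>\<^sub>2 | C \<Rightarrow> \<alpha>\<^sub>3)" for c
  have \<alpha> [simp]: "\<alpha> A = \<alpha>\<^sub>1" "\<alpha> B = \<alpha>\<^sub>2" "\<alpha> C = \<alpha>\<^sub>3" by (simp_all add: \<alpha>_def)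
  have ex_colour_iff: "(\<exists>c. P c) \<longleftrightarrow> P A \<or> P B \<or> P C" for P by (metis colour.exhaust)
  interpret inversion_partition n \<alpha>
  proof
    show "\<alpha> c permutes {1..n}" for c using assms by (cases c) auto
    show "\<exists>c. \<alpha> c j < \<alpha> c i" if "(i, j) \<in> Delta n" for i j
    proof -
      have "(i, j) \<in> Phi n \<alpha>\<^sub>1 \<union> Phi n \<alpha>\<^sub>2 \<union> Phi n \<alpha>\<^sub>3" using that assms(5) by simp
      then show ?thesis by (auto simp: ex_colour_iff Phi_def)
    qed
    show "c = d" if "(i, j) \<in> Delta n" "\<alpha> c j < \<alpha> c i" "\<alpha> d j < \<alpha> d i" for c d i j
    proof -
      have "(i, j) \<in> Phi n (\<alpha> c)" "(i, j) \<in> Phi n (\<alpha> d)" using that by (auto simp: Phi_def)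
      then show ?thesis using assms(6-8) by (cases c; cases d) auto
    qed
  qed
  have S: "S_set n \<alpha>\<^sub>1 \<alpha>\<^sub>2 \<alpha>\<^sub>3 = root_vec ` edges n"
  proof -
    have "S_set n \<alpha>\<^sub>1 \<alpha>\<^sub>2 \<alpha>\<^sub>3 =
        root_vec ` {p \<in> Delta n. \<exists>c. - act (\<alpha> c) (root_vec p) \<in> simple_roots n}"
      by (auto simp: S_set_def ex_colour_iff)
    also have "{p \<in> Delta n. \<exists>c. - act (\<alpha> c) (root_vec p) \<in> simple_roots n} = edges n"
      using uminus_act_simple_iff by (auto simp: edges_def edge_def)
    finally show ?thesis .
  qed
  have pivot: "pivot_var n \<alpha>\<^sub>1 \<alpha>\<^sub>2 \<alpha>\<^sub>3 (root_vec (i, j)) = variable c (\<alpha> c j)"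
    and free: "free_vars n \<alpha>\<^sub>1 \<alpha>\<^sub>2 \<alpha>\<^sub>3 (root_vec (i, j)) =
      {variable d k | d k. d \<noteq> c \<and> \<alpha> d i \<le> k \<and> k < \<alpha> d j}"
    if e: "edge n c i j" for c i j
  proof -
    have D: "(i, j) \<in> Delta n" "\<alpha> c j < \<alpha> c i" using e by (auto simp: edge_def)
    \<comment> \<open>Uniqueness of the colour selects exactly one branch in the definitions of
      pivot and free variables.\<close>
    have neg: "negative_root n (act (\<alpha> d) (root_vec (i, j))) \<longleftrightarrow> d = c" for d
      using negative_root_iff[OF D(1)] D colour_unique by blast
    have seg: "segment n (act (\<alpha> d) (root_vec (i, j))) = {\<alpha> d i..<\<alpha> d j}" if "d \<noteq> c" for d
      using segment_not_inverted D that colour_unique by blast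
    show "pivot_var n \<alpha>\<^sub>1 \<alpha>\<^sub>2 \<alpha>\<^sub>3 (root_vec (i, j)) = variable c (\<alpha> c j)"
      using neg[of A] neg[of B] simple_index_edge[OF e] by (cases c) (auto simp: pivot_var_def)
    show "free_vars n \<alpha>\<^sub>1 \<alpha>\<^sub>2 \<alpha>\<^sub>3 (root_vec (i, j)) =
        {variable d k | d k. d \<noteq> c \<and> \<alpha> d i \<le> k \<and> k < \<alpha> d j}"
      using neg[of A] neg[of B] seg[of A] seg[of B] seg[of C]
      by (cases c) (auto simp: free_vars_def ex_colour_iff)
  qed
  have no_free: "pivot_var n \<alpha>\<^sub>1 \<alpha>\<^sub>2 \<alpha>\<^sub>3 (root_vec x) \<notin> free_vars n \<alpha>\<^sub>1 \<alpha>\<^sub>2 \<alpha>\<^sub>3 (root_vec y)"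
    if xy: "x \<in> edges n" "y \<in> edges n" "snd y - fst y \<le> snd x - fst x" for x y
  proof
    assume mem: "pivot_var n \<alpha>\<^sub>1 \<alpha>\<^sub>2 \<alpha>\<^sub>3 (root_vec x) \<in> free_vars n \<alpha>\<^sub>1 \<alpha>\<^sub>2 \<alpha>\<^sub>3 (root_vec y)"
    obtain p q d where x: "x = (p, q)" "edge n d p q" using xy(1) unfolding edges_def by blast
    obtain i j c where y: "y = (i, j)" "edge n c i j" using xy(2) unfolding edges_def by blast
    have "d \<noteq> c" "\<alpha> d i \<le> \<alpha> d q" "\<alpha> d q < \<alpha> d j"
      using mem unfolding x y pivot[OF x(2)] free[OF y(2)] by (auto simp: variable_eq_iff)
    \<comment> \<open>Since the values at \<open>p\<close> and \<open>q\<close> are consecutive,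
      \<open>\<alpha> d q < \<alpha> d j\<close> becomes
      \<open>\<alpha> d p \<le> \<alpha> d j\<close>, the remaining hypothesis of
      \<open>straddled_nested\<close>.\<close>
    moreover have "(p, q) \<in> Delta n" "\<alpha> d p = Suc (\<alpha> d q)" using x by (auto simp: edge_iff)
    ultimately have "q - p < j - i" by (intro straddled_nested[OF y(2), of p q d]) auto
    then show False using xy(3) x y by simp
  qed
  \<comment> \<open>Edges are labelled by decreasing length. Ties may be broken arbitrarily, because
    a pivot variable that is free for another edge forces that edge to be strictly longer.\<close>
  obtain g where g: "bij_betw g {1..n - 1} (edges n)"
    "\<And>i j. i \<in> {1..n - 1} \<Longrightarrow> j \<in> {1..n - 1} \<Longrightarrow> i < j \<Longrightarrow>
       snd (g j) - fst (g j) \<le> snd (g i) - fst (g i)"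
    using ex_bij_betw_antimono[OF finite_edges[of n], of "\<lambda>x. snd x - fst x"]
      edges_basis(2)[OF assms(1)] by auto
  have "bij_betw root_vec (edges n) (root_vec ` edges n)"
    by (rule inj_on_imp_bij_betw[OF inj_on_subset[OF inj_on_root_vec edges_subset]])
  then have "bij_betw (root_vec \<circ> g) {1..n - 1} (root_vec ` edges n)"
    by (rule bij_betw_trans[OF g(1)])
  moreover have "\<forall>i\<in>{1..n - 1}. \<forall>j\<in>{1..n - 1}. i < j \<longrightarrow>
      pivot_var n \<alpha>\<^sub>1 \<alpha>\<^sub>2 \<alpha>\<^sub>3 ((root_vec \<circ> g) i) \<notin> free_vars n \<alpha>\<^sub>1 \<alpha>\<^sub>2 \<alpha>\<^sub>3 ((root_vec \<circ> g) j)"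
    using no_free g bij_betwE[OF g(1)] by simp
  ultimately show ?thesis
    using independent_edges edges_basis(1)[OF assms(1)] unfolding S by blast
qed

end
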